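(* Let $\mathcal{C}$ be an $[n,k,d]_q$ MDS code of distance $d\ge 2$ and covering radius $R=d-1$. Then all its cosets $\mathcal{V}^{(d-1)}$ of weight $d-1$ have the weight distribution $$B_w(\mathcal{V}^{(d-1)})=0\ \text{ if } w=0,1,\ldots,d-2;\qquad B_{d-1}(\mathcal{V}^{(d-1)})=\binom{n}{d-1};$$ $$B_w(\mathcal{V}^{(d-1)})=A_w(\mathcal{C})-\Omega_w^{(0)}(n,d)\ \text{ if } w=d,d+1,\ldots,n.$$
   Context: An $[n,k,d]_q$ code is a $k$-dimensional $\mathbb{F}_q$-linear subspace of $\mathbb{F}_q^n$ with minimum Hamming distance $d$; it is MDS if $d=n-k+1$. Its covering radius is the least integer $R$ such that every vector of $\mathbb{F}_q^n$ is within Hamming distance $R$ of some codeword. A coset of $\mathcal{C}$ is a translate $\mathcal{C}+\mathbf{v}$, $\mathbf{v}\in\mathbb{F}_q^n$; the weight of a coset is the smallest Hamming weight of a vector in it. $A_w(\mathcal{C})$ is the number of codewords of Hamming weight $w$ in $\mathcal{C}$, and $B_w(\mathcal{V})$ is the number of vectors of Hamming weight $w$ in the coset $\mathcal{V}$. Notation: $\Omega_w^{(v)}(n,d)=(-1)^{w-d}\binom{n-v}{w-v}\binom{w-1-v}{d-2-v}$. *)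

theory Defs
  imports "HOL-Analysis.Cartesian_Space"
begin

text \<open>
  The ambient space \<open>F_q^n\<close> is \<^typ>\<open>'a ^ 'n\<close> with \<open>'a\<close> a finite field (so \<open>q = CARD('a)\<close>) and
  \<open>n = CARD('n)\<close>. Linear subspaces and dimension over \<open>'a\<close> are the library's
  \<^const>\<open>vec.subspace\<close> and \<^const>\<open>vec.dim\<close>.
\<close>

definition hamming_weight :: "'a::zero ^ 'n::finite \<Rightarrow> nat" where
  "hamming_weight x = card {i. x $ i \<noteq> 0}"

definition hamming_dist :: "'a ^ 'n::finite \<Rightarrow> 'a ^ 'n \<Rightarrow> nat" where
  "hamming_dist x y = card {i. x $ i \<noteq> y $ i}"

definition min_distance :: "('a ^ 'n::finite) set \<Rightarrow> nat" where
  "min_distance C = Min {hamming_dist x y | x y. x \<in> C \<and> y \<in> C \<and> x \<noteq> y}"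

text \<open>
  The condition \<open>1 \<le> k\<close> only says that the minimum distance exists: the zero code has no two
  distinct codewords, and \<^const>\<open>min_distance\<close> is unspecified for it.
\<close>

definition linear_code :: "('a::{field,finite} ^ 'n::finite) set \<Rightarrow> nat \<Rightarrow> nat \<Rightarrow> nat \<Rightarrow> bool" where
  "linear_code C n k d \<longleftrightarrow>
     n = CARD('n) \<and> vec.subspace C \<and> vec.dim C = k \<and> 1 \<le> k \<and> min_distance C = d"

text \<open>The subtraction does not truncate, since \<open>k \<le> n\<close> for every linear code.\<close>

definition MDS_code :: "('a::{field,finite} ^ 'n::finite) set \<Rightarrow> nat \<Rightarrow> nat \<Rightarrow> nat \<Rightarrow> bool" where
  "MDS_code C n k d \<longleftrightarrow> linear_code C n k d \<and> d = n - k + 1"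

definition covering_radius :: "('a ^ 'n::finite) set \<Rightarrow> nat" where
  "covering_radius C = (LEAST R. \<forall>v. \<exists>c\<in>C. hamming_dist v c \<le> R)"

definition is_coset :: "('a::plus ^ 'n::finite) set \<Rightarrow> ('a ^ 'n) set \<Rightarrow> bool" where
  "is_coset C V \<longleftrightarrow> (\<exists>v. V = {c + v | c. c \<in> C})"

definition coset_weight :: "('a::zero ^ 'n::finite) set \<Rightarrow> nat" where
  "coset_weight V = Min (hamming_weight ` V)"

text \<open>This is both \<open>A_w(C)\<close>, for a code, and \<open>B_w(V)\<close>, for a coset.\<close>

definition weight_count :: "('a::zero ^ 'n::finite) set \<Rightarrow> nat \<Rightarrow> nat" where
  "weight_count S w = card {x \<in> S. hamming_weight x = w}"

text \<open>
  \<open>Omega v w n d\<close> is \<open>\<Omega>_w^(v)(n,d)\<close>. The natural-number subtractions are exact for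
  \<open>v + 2 \<le> d \<le> w \<le> n\<close>.
\<close>

definition Omega :: "nat \<Rightarrow> nat \<Rightarrow> nat \<Rightarrow> nat \<Rightarrow> int" where
  "Omega v w n d =
     (-1) ^ (w - d) * int ((n - v) choose (w - v)) * int ((w - 1 - v) choose (d - 2 - v))"

end

theory Submission
  imports Defs
begin

text \<open>
  Compare the vectors of a coset \<open>V\<close> and of the code \<open>C\<close> that are supported in a set \<open>T\<close> of
  coordinates. Because \<open>C\<close> is MDS, every \<open>k = n - d + 1\<close> coordinates are an information set, so for
  \<open>|T| \<ge> d - 1\<close> some vector of \<open>V\<close> is supported in \<open>T\<close>, and translation by it shows that the two
  numbers are equal. For \<open>|T| \<le> d - 2\<close> there is no such vector in \<open>V\<close> and only \<open>0\<close> in \<open>C\<close>. Moebius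
  inversion over the subsets of \<open>T\<close> then determines the difference of the numbers of vectors with
  support exactly \<open>T\<close> as a truncated alternating sum of binomial coefficients, which
  has a closed form.
\<close>

definition support :: "'a::zero ^ 'n::finite \<Rightarrow> 'n set" where
  "support x = {i. x $ i \<noteq> 0}"

lemma hamming_weight_eq_card_support: "hamming_weight x = card (support x)"
  by (simp add: hamming_weight_def support_def)

lemma support_subset_iff: "support x \<subseteq> T \<longleftrightarrow> (\<forall>i. i \<notin> T \<longrightarrow> x $ i = 0)"
  by (auto simp: support_def)

subsection \<open>Alternating binomial sums\<close>

text \<open>Pascal's rule makes the partial sums telescope. Writing the row as \<open>Suc w\<close>
  excludes row 0, where the formula with the predecessor would fail.\<close>

lemma sum_alternating_choose_atMost:
  "(\<Sum>j\<le>m. (-1) ^ j * int (Suc w choose j)) = (-1) ^ m * int (w choose m)"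
  by (induction m) (auto simp: algebra_simps)

lemma sum_Pow_card:
  fixes g :: "nat \<Rightarrow> 'b::comm_semiring_1"
  assumes "finite T"
  shows "(\<Sum>S\<in>Pow T. g (card S)) = (\<Sum>j\<le>card T. of_nat (card T choose j) * g j)"
proof -
  have "(\<Sum>S\<in>Pow T. g (card S)) =
      (\<Sum>j\<le>card T. \<Sum>S | S \<in> Pow T \<and> card S = j. g (card S))"
    by (rule sum.group [symmetric]) (use assms in \<open>auto simp: card_mono\<close>)
  also have "\<dots> = (\<Sum>j\<le>card T. of_nat (card T choose j) * g j)"
    using assms by (intro sum.cong) (auto simp: n_subsets)
  finally show ?thesis .
qed

text \<open>The left side is the Moebius inverse, at \<open>T\<close>, of the function that is -1 on
  sets of at most \<open>m\<close> elements and 0 on larger ones. Grouping the subsets by size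
  leaves a truncated alternating row sum; \<open>m < card T\<close> makes that row a
  successor.\<close>

lemma sum_Pow_alternating_truncated:
  assumes "finite T" "m < card T"
  shows "(\<Sum>S\<in>Pow T. (-1) ^ (card T - card S) * (if card S \<le> m then -1 else 0)) =
           - ((-1) ^ (card T - m) * int (card T - 1 choose m))"
proof -
  define w where "w = card T"
  obtain w' where w': "w = Suc w'"
    using assms by (cases w) (auto simp: w_def)
  have sign: "(-1::int) ^ (w - j) = (-1) ^ w * (-1) ^ j" if "j \<le> w" for j
    using that by (simp add: minus_one_power_iff)
  have "(\<Sum>S\<in>Pow T. (-1) ^ (w - card S) * (if card S \<le> m then -1 else 0::int)) =
      (\<Sum>j\<le>w. int (w choose j) * ((-1) ^ (w - j) * (if j \<le> m then -1 else 0)))"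
    unfolding w_def by (rule sum_Pow_card [OF assms(1), where 'b = int, simplified])
  also have "\<dots> = (\<Sum>j\<le>m. int (w choose j) * ((-1) ^ (w - j) * -1))"
    using assms(2) by (intro sum.mono_neutral_cong_right) (auto simp: w_def)
  also have "\<dots> = - ((-1) ^ w * (\<Sum>j\<le>m. (-1) ^ j * int (w choose j)))"
    unfolding sum_distrib_left sum_negf [symmetric]
    using assms(2) by (intro sum.cong) (auto simp: sign simp flip: w_def)
  also have "\<dots> = - ((-1) ^ (w - m) * int (w - 1 choose m))"
    using sign [of m] assms(2) by (simp add: w' sum_alternating_choose_atMost flip: w_def)
  finally show ?thesis
    by (simp add: w_def)
qed

subsection \<open>Counting vectors by support\<close>

lemma card_support_subset_eq_sum:
  fixes V :: "('a::{zero,finite} ^ 'n::finite) set"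
  shows "card {x \<in> V. support x \<subseteq> T} = (\<Sum>S\<in>Pow T. card {x \<in> V. support x = S})"
proof -
  have "{x \<in> V. support x \<subseteq> T} = (\<Union>S\<in>Pow T. {x \<in> V. support x = S})"
    by auto
  moreover have "card (\<Union>S\<in>Pow T. {x \<in> V. support x = S}) =
      (\<Sum>S\<in>Pow T. card {x \<in> V. support x = S})"
    by (rule card_UN_disjoint) auto
  ultimately show ?thesis
    by simp
qed

lemma weight_count_eq_sum:
  fixes V :: "('a::{zero,finite} ^ 'n::finite) set"
  shows "weight_count V w = (\<Sum>T | card T = w. card {x \<in> V. support x = T})"
proof -
  have "{x \<in> V. hamming_weight x = w} = (\<Union>T\<in>{T. card T = w}. {x \<in> V. support x = T})"
    by (auto simp: hamming_weight_eq_card_support)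
  moreover have "card (\<Union>T\<in>{T. card T = w}. {x \<in> V. support x = T}) =
      (\<Sum>T | card T = w. card {x \<in> V. support x = T})"
    by (rule card_UN_disjoint) auto
  ultimately show ?thesis
    by (simp add: weight_count_def)
qed

text \<open>Moebius inversion passes from support inside \<open>T\<close> to support equal to
  \<open>T\<close>. The resulting difference depends only on \<open>card T\<close>, so summing over
  all \<open>T\<close> of size \<open>w\<close> contributes just the factor
  \<open>CARD('n) choose w\<close>.\<close>

lemma weight_count_difference:
  fixes C V :: "('a::{zero,finite} ^ 'n::finite) set"
  assumes diff: "\<And>T. int (card {x \<in> V. support x \<subseteq> T}) - int (card {x \<in> C. support x \<subseteq> T}) =
             (if card T \<le> m then -1 else 0)"
    and "m < w"
  shows "int (weight_count V w) - int (weight_count C w) =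
           - ((-1) ^ (w - m) * int (CARD('n) choose w) * int (w - 1 choose m))"
proof -
  define e where "e T = int (card {x \<in> V. support x = T}) - int (card {x \<in> C. support x = T})" for T
  have e: "e T = - ((-1) ^ (w - m) * int (w - 1 choose m))" if "card T = w" for T
  proof -
    have "e T = (\<Sum>S\<in>Pow T. (-1) ^ (card T - card S) * (if card S \<le> m then -1 else 0))"
    proof (rule inclusion_exclusion_mobius)
      show "(if card S \<le> m then -1 else 0) = sum e (Pow S)" for S
        using diff [of S]
        by (simp add: e_def card_support_subset_eq_sum sum_subtractf)
    qed simp
    then show ?thesis
      using sum_Pow_alternating_truncated [of T m] that \<open>m < w\<close> by simp
  qed
  have "int (weight_count V w) - int (weight_count C w) = (\<Sum>T | card T = w. e T)"
    by (simp add: weight_count_eq_sum e_def sum_subtractf)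
  also have "\<dots> = (\<Sum>T\<in>{T::'n set. card T = w}. - ((-1) ^ (w - m) * int (w - 1 choose m)))"
    by (intro sum.cong) (auto simp: e)
  also have "\<dots> = - ((-1) ^ (w - m) * int (CARD('n) choose w) * int (w - 1 choose m))"
    using n_subsets [of "UNIV :: 'n set" w] by simp
  finally show ?thesis .
qed

subsection \<open>Codes and their cosets\<close>

lemma hamming_weight_ge_min_distance:
  fixes C :: "('a::{field,finite} ^ 'n::finite) set"
  assumes "vec.subspace C" "x \<in> C" "x \<noteq> 0"
  shows "min_distance C \<le> hamming_weight x"
  unfolding min_distance_def
proof (rule Min_le)
  have "finite ((\<lambda>(x, y). hamming_dist x y) ` (C \<times> C))"
    by simp
  then show "finite {hamming_dist x y | x y. x \<in> C \<and> y \<in> C \<and> x \<noteq> y}"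
    by (rule rev_finite_subset) auto
  have "hamming_weight x = hamming_dist x 0"
    by (simp add: hamming_weight_def hamming_dist_def)
  then show "hamming_weight x \<in> {hamming_dist x y | x y. x \<in> C \<and> y \<in> C \<and> x \<noteq> y}"
    using assms vec.subspace_0 by blast
qed

text \<open>Vectors supported in \<open>T\<close> are closed under sums and differences, so
  translation by \<open>x\<close> preserves this condition while it carries \<open>C\<close> onto
  \<open>V\<close>.\<close>

lemma card_translate_support_subset:
  fixes C :: "('a::{field,finite} ^ 'n::finite) set"
  assumes C: "vec.subspace C" and V: "V = {c + v | c. c \<in> C}"
    and x: "x \<in> V" "support x \<subseteq> T"
  shows "card {y \<in> V. support y \<subseteq> T} = card {c \<in> C. support c \<subseteq> T}"
proof -
  obtain b where b: "b \<in> C" "x = b + v"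
    using x V by auto
  have in_V: "y \<in> V \<longleftrightarrow> y - v \<in> C" for y
    by (auto simp: V intro!: exI [of _ "y - v"])
  have plus: "c + x \<in> V" if "c \<in> C" for c
    using vec.subspace_add [OF C that b(1)] by (simp add: in_V b(2) algebra_simps)
  have minus: "y - x \<in> C" if "y \<in> V" for y
    using vec.subspace_diff [OF C _ b(1), of "y - v"] that
    by (simp add: in_V b(2) diff_diff_eq add.commute)
  have "bij_betw (\<lambda>c. c + x) {c \<in> C. support c \<subseteq> T} {y \<in> V. support y \<subseteq> T}"
  proof (rule bij_betwI [where g = "\<lambda>y. y - x"])
    show "(\<lambda>c. c + x) \<in> {c \<in> C. support c \<subseteq> T} \<rightarrow> {y \<in> V. support y \<subseteq> T}"
      using x(2) by (auto simp: plus support_subset_iff)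
    show "(\<lambda>y. y - x) \<in> {y \<in> V. support y \<subseteq> T} \<rightarrow> {c \<in> C. support c \<subseteq> T}"
      using x(2) by (auto simp: minus support_subset_iff)
  qed auto
  then show ?thesis
    by (simp add: bij_betw_same_card)
qed

text \<open>Two codewords that agree on \<open>S\<close> differ in at most n - k < d places, so
  restriction to \<open>S\<close> is injective on \<open>C\<close>; comparing dimensions makes it
  surjective.\<close>

lemma MDS_code_information_set:
  fixes C :: "('a::{field,finite} ^ 'n::finite) set"
  assumes mds: "MDS_code C n k d" and card: "card S = k"
  obtains c where "c \<in> C" "\<And>i. i \<in> S \<Longrightarrow> c $ i = y $ i"
proof -
  have C: "vec.subspace C" and dim: "vec.dim C = k" and d: "min_distance C = d" "d = n - k + 1"
    and n: "n = CARD('n)"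
    using mds by (auto simp: MDS_code_def linear_code_def)
  \<comment> \<open>Restriction to \<open>S\<close> is modelled by zeroing the other coordinates, so
    that image and target \<open>U\<close> are subspaces of the same space and dimension comparison
    applies.\<close>
  define P :: "'a ^ 'n \<Rightarrow> 'a ^ 'n" where "P x = (\<chi> i. if i \<in> S then x $ i else 0)" for x
  define U :: "('a ^ 'n) set" where "U = {x. \<forall>i. i \<notin> S \<longrightarrow> x $ i = 0}"
  have lin: "Vector_Spaces.linear (*s) (*s) P"
    by unfold_locales (auto simp: P_def vec_eq_iff)
  have inj: "inj_on P C"
  proof (rule inj_onI)
    fix a b assume ab: "a \<in> C" "b \<in> C" "P a = P b"
    have "support (a - b) \<subseteq> - S"
      using ab(3) by (auto simp: support_def P_def vec_eq_iff split: if_splits)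
    then have "card (support (a - b)) \<le> card (- S)"
      by (intro card_mono) auto
    also have "card (- S) < d"
      using card d n by (simp add: Compl_eq_Diff_UNIV card_Diff_subset)
    finally show "a = b"
      using hamming_weight_ge_min_distance [OF C, of "a - b"] vec.subspace_diff [OF C] ab(1,2) d
      by (force simp: hamming_weight_eq_card_support)
  qed
  have "P ` C = U"
  proof (rule vec.subspace_dim_equal)
    show "vec.subspace (P ` C)"
      by (rule vec.linear_subspace_image [OF lin C])
    show "vec.subspace U"
      by (auto simp: U_def vec.subspace_def)
    show "P ` C \<subseteq> U"
      by (auto simp: U_def P_def)
    have "vec.dim (P ` C) = vec.dim C"
      using C inj by (intro vec.dim_image_eq lin) (simp add: vec.span_eq_iff [THEN iffD2])
    then show "vec.dim U \<le> vec.dim (P ` C)"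
      by (simp add: U_def dim_substandard_cart card dim)
  qed
  moreover have "P y \<in> U"
    by (simp add: U_def P_def)
  ultimately obtain c where c: "c \<in> C" "P y = P c"
    by (metis imageE)
  show thesis
  proof (rule that [OF c(1)])
    show "c $ i = y $ i" if "i \<in> S" for i
      using c(2) that by (auto simp: P_def vec_eq_iff dest: spec [of _ i])
  qed
qed

text \<open>The complement of \<open>T\<close> has at most \<open>k\<close> elements, so it extends
  to an information set, on which a codeword can be chosen to cancel \<open>v\<close>.\<close>

lemma MDS_code_coset_meets_support:
  fixes C :: "('a::{field,finite} ^ 'n::finite) set"
  assumes mds: "MDS_code C n k d" and V: "V = {c + v | c. c \<in> C}" and T: "d - 1 \<le> card T"
  obtains x where "x \<in> V" "support x \<subseteq> T"
proof -
  have n: "n = CARD('n)" and k: "vec.dim C = k" and d: "d = n - k + 1"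
    using mds by (auto simp: MDS_code_def linear_code_def)
  have "k \<le> n"
    using vec.dim_subset_UNIV [of C] by (simp add: k n vec.dimension_def card_cart_basis)
  then have "card (- T) \<le> k"
    using T d n by (simp add: Compl_eq_Diff_UNIV card_Diff_subset)
  then obtain S where S: "- T \<subseteq> S" "card S = k"
    using \<open>k \<le> n\<close> n exists_subset_between [of "- T" k UNIV] by auto
  obtain c where c: "c \<in> C" "\<And>i. i \<in> S \<Longrightarrow> c $ i = (- v) $ i"
    using MDS_code_information_set [OF mds S(2)] by blast
  show thesis
  proof (rule that)
    show "c + v \<in> V"
      using V c(1) by blast
    show "support (c + v) \<subseteq> T"
      using S(1) c(2) by (auto simp: support_subset_iff)
  qed
qed

text \<open>The value jumps between sizes d - 2 and d - 1: on the small sets only the zero codeword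
  is counted, hence -1; on the others translation matches the two counts.\<close>

lemma MDS_code_coset_support_difference:
  fixes C :: "('a::{field,finite} ^ 'n::finite) set"
  assumes mds: "MDS_code C n k d" and "2 \<le> d" and V: "V = {c + v | c. c \<in> C}"
    and low: "\<And>x. x \<in> V \<Longrightarrow> d - 1 \<le> hamming_weight x"
  shows "int (card {x \<in> V. support x \<subseteq> T}) - int (card {x \<in> C. support x \<subseteq> T}) =
           (if card T \<le> d - 2 then -1 else 0)"
proof -
  have C: "vec.subspace C" and d: "min_distance C = d"
    using mds by (auto simp: MDS_code_def linear_code_def)
  show ?thesis
  proof (cases "card T \<le> d - 2")
    case True
    have small: "hamming_weight x < d - 1" if "support x \<subseteq> T" for x :: "'a ^ 'n"
      using card_mono [OF _ that] True \<open>2 \<le> d\<close>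
      by (simp add: hamming_weight_eq_card_support)
    have "{x \<in> V. support x \<subseteq> T} = {}"
      using small low by fastforce
    moreover have "{x \<in> C. support x \<subseteq> T} = {0}"
    proof (intro equalityI subsetI)
      fix x assume "x \<in> {x \<in> C. support x \<subseteq> T}"
      then show "x \<in> {0}"
        using small [of x] hamming_weight_ge_min_distance [OF C, of x] d by fastforce
    qed (use vec.subspace_0 [OF C] in \<open>auto simp: support_def\<close>)
    ultimately show ?thesis
      using True by (simp del: mem_Collect_eq)
  next
    case False
    then have "d - 1 \<le> card T"
      by simp
    then obtain x where "x \<in> V" "support x \<subseteq> T"
      using MDS_code_coset_meets_support [OF mds V] by blast
    then show ?thesis
      using card_translate_support_subset [OF C V] False by simp
  qed
qed

theorem theorem4p2:
  fixes C :: "('a::{field,finite} ^ 'n::finite) set"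
    and n k d :: nat
  assumes "MDS_code C n k d"
    and "2 \<le> d"
    and "covering_radius C = d - 1"
  shows "\<forall>V. is_coset C V \<and> coset_weight V = d - 1 \<longrightarrow>
           (\<forall>w. w \<le> d - 2 \<longrightarrow> weight_count V w = 0) \<and>
           weight_count V (d - 1) = n choose (d - 1) \<and>
           (\<forall>w. d \<le> w \<and> w \<le> n \<longrightarrow>
              int (weight_count V w) = int (weight_count C w) - Omega 0 w n d)"
proof (intro allI impI)
  fix V assume V: "is_coset C V \<and> coset_weight V = d - 1"
  then obtain v where v: "V = {c + v | c. c \<in> C}"
    by (auto simp: is_coset_def)
  have C: "vec.subspace C" and d: "min_distance C = d" and n: "n = CARD('n)"
    using assms(1) by (auto simp: MDS_code_def linear_code_def)
  have low: "d - 1 \<le> hamming_weight x" if "x \<in> V" for x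
    using V that by (auto simp: coset_weight_def dest: sym)
  \<comment> \<open>The range starts at d - 1 rather than d, so that one formula also yields the
    count at the minimum weight of the coset.\<close>
  have diff: "int (weight_count V w) - int (weight_count C w) =
      - ((-1) ^ (w - (d - 2)) * int (n choose w) * int (w - 1 choose (d - 2)))" if "d - 1 \<le> w" for w
    unfolding n
    by (rule weight_count_difference
        [OF MDS_code_coset_support_difference [OF assms(1,2) v low]]) (use that assms(2) in auto)
  have "weight_count V w = 0" if "w \<le> d - 2" for w
    using low that assms(2) by (force simp: weight_count_def)
  moreover have "weight_count V (d - 1) = n choose (d - 1)"
  proof -
    have "{x \<in> C. hamming_weight x = d - 1} = {}"
    proof -
      \<comment> \<open>The zero word is excluded because d - 1 is positive, any other word because
        its weight is at least \<open>d\<close>.\<close>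
      have False if "x \<in> C" "hamming_weight x = d - 1" for x
        using that hamming_weight_ge_min_distance [OF C, of x] d assms(2)
        by (cases "x = 0") (auto simp: hamming_weight_def)
      then show ?thesis
        by blast
    qed
    \<comment> \<open>At weight d - 1 the sign in \<open>diff\<close> is thus -1 and the last
      binomial coefficient is 1, which leaves \<open>n choose (d - 1)\<close>.\<close>
    moreover have "d - 1 - (d - 2) = 1" "d - 1 - 1 = d - 2"
      using assms(2) by auto
    ultimately show ?thesis
      using diff [of "d - 1"] by (simp add: weight_count_def del: Collect_empty_eq)
  qed
  moreover have "int (weight_count V w) = int (weight_count C w) - Omega 0 w n d"
    if "d \<le> w \<and> w \<le> n" for w
  proof -
    \<comment> \<open>The exponents in \<open>diff\<close> and \<open>Omega\<close> differ by 2, so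
      the signs agree.\<close>
    have "w - (d - 2) = w - d + 2"
      using that assms(2) by linarith
    then show ?thesis
      using diff [of w] that by (auto simp: Omega_def algebra_simps)
  qed
  ultimately show "(\<forall>w. w \<le> d - 2 \<longrightarrow> weight_count V w = 0) \<and>
      weight_count V (d - 1) = n choose (d - 1) \<and>
      (\<forall>w. d \<le> w \<and> w \<le> n \<longrightarrow>
         int (weight_count V w) = int (weight_count C w) - Omega 0 w n d)"
    by blast
qed

end
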